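(* Let $m,s\in\mathbb{N}$ with $m\le s$, and let $\{u_1,\ldots,u_m\}$ be a partition of $[1:s]=\{1,\ldots,s\}$ into nonempty pairwise disjoint subsets with union $[1:s]$. A function $f\in L^2([0,1]^s)$ is separable with respect to $\boldsymbol{x}_{u_1},\ldots,\boldsymbol{x}_{u_m}$ if and only if \[ \sum_{j=1}^{m}\underline{\tau}^2_{u_j}=\sigma^2 , \] where $\sigma^2$ is the variance of $f$ and $\underline{\tau}^2_{u}$ is the Sobol' index of $f$ for the subset $u$, as defined in the context.
   Context: Notation: functions are real-valued; $\boldsymbol{x}=(x_1,\ldots,x_s)$; for $u\subseteq[1:s]$, $\boldsymbol{x}_u=(x_j)_{j\in u}$, $-u=[1:s]\setminus u$, and $|u|$ is the cardinality of $u$. ANOVA decomposition: for $f\in L^2([0,1]^s)$, define $f_\emptyset=\int_{[0,1]^s}f(\boldsymbol{x})\,\mathrm{d}\boldsymbol{x}$ and recursively, for $\emptyset\ne u\subseteq[1:s]$, \[ f_u(\boldsymbol{x}_u)=\int_{[0,1]^{s-|u|}}f(\boldsymbol{x})\,\mathrm{d}\boldsymbol{x}_{-u}-\sum_{v\subsetneq u}f_v(\boldsymbol{x}_v), \] so that $f=\sum_{u\subseteq[1:s]}f_u$. (For $u=[1:s]$ the integral is $f$ itself.) Put \[ \sigma^2=\int_{[0,1]^s}f^2(\boldsymbol{x})\,\mathrm{d}\boldsymbol{x}-\left(\int_{[0,1]^s}f(\boldsymbol{x})\,\mathrm{d}\boldsymbol{x}\right)^2,\qquad \sigma_u^2=\int_{[0,1]^{|u|}}f_u^2(\boldsymbol{x}_u)\,\mathrm{d}\boldsymbol{x}_u,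 \qquad \underline{\tau}^2_u=\sum_{\emptyset\ne v\subseteq u}\sigma_v^2 \] for $\emptyset\ne u\subseteq[1:s]$. Separability: $f$ is separable with respect to $\boldsymbol{x}_{u_1},\ldots,\boldsymbol{x}_{u_m}$ if there exist functions $g_1,\ldots,g_m$ such that $f(\boldsymbol{x})=\sum_{j=1}^m g_j(\boldsymbol{x}_{u_j})$ holds for any $\boldsymbol{x}\in[0,1]^s$.
   Formalization: Separability is understood up to a null set: some function equal to f almost everywhere is separable at every point of the cube; with pointwise separability of f itself the "if" part fails, e.g. for the indicator of one point when s=m=2. *)

theory Defs
  imports "HOL-Probability.Probability"
begin

text \<open>
  A point \<open>x\<^sub>u\<close> of \<open>[0,1]\<^sup>u\<close> is an element of \<open>u \<rightarrow>\<^sub>E {0..1}\<close>, and passing from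
  \<open>x\<close> to its subvector \<open>x\<^sub>u\<close> is \<open>restrict x u\<close>. The finite product of Borel
  measures is completed, so that this is Lebesgue measure and measurability with respect
  to it is Lebesgue measurability. For \<open>u = {}\<close> it is the unit mass at the empty vector.
\<close>

definition unit_cube :: "nat set \<Rightarrow> (nat \<Rightarrow> real) measure" where
  "unit_cube u = completion (\<Pi>\<^sub>M i\<in>u. restrict_space lborel {0..1})"

definition square_integrable :: "'a measure \<Rightarrow> ('a \<Rightarrow> real) \<Rightarrow> bool" where
  "square_integrable M f \<longleftrightarrow> f \<in> borel_measurable M \<and> integrable M (\<lambda>x. (f x)\<^sup>2)"

text \<open>
  The ANOVA component \<open>f\<^sub>u\<close> of a function on the \<open>s\<close>-dimensional cube. The recursion
  includes the case \<open>u = {}\<close>, where the sum is empty and the integral is over all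
  coordinates (\<open>anova_empty\<close>), and \<open>u = {1..s}\<close>, where the integral is over
  the empty cube and returns \<open>f\<close> (\<open>integral_unit_cube_empty\<close>). The value for \<open>u\<close> not contained in
  \<open>{1..s}\<close> is a dummy.
\<close>

function anova :: "nat \<Rightarrow> ((nat \<Rightarrow> real) \<Rightarrow> real) \<Rightarrow> nat set \<Rightarrow> (nat \<Rightarrow> real) \<Rightarrow> real" where
  "anova s f u x =
     (if u \<subseteq> {1..s}
      then (\<integral>y. f (merge u ({1..s} - u) (x, y)) \<partial>unit_cube ({1..s} - u))
           - (\<Sum>v\<in>{v. v \<subset> u}. anova s f v (restrict x v))
      else 0)"
  by pat_completeness auto
termination
  by (relation "Wellfounded.measure (\<lambda>(s, f, u, x). card u)")
     (auto intro!: psubset_card_mono intro: finite_subset)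

declare anova.simps [simp del]

definition variance_cube :: "nat \<Rightarrow> ((nat \<Rightarrow> real) \<Rightarrow> real) \<Rightarrow> real" where
  "variance_cube s f =
     (\<integral>x. (f x)\<^sup>2 \<partial>unit_cube {1..s}) - (\<integral>x. f x \<partial>unit_cube {1..s})\<^sup>2"

definition anova_variance :: "nat \<Rightarrow> ((nat \<Rightarrow> real) \<Rightarrow> real) \<Rightarrow> nat set \<Rightarrow> real" where
  "anova_variance s f u = (\<integral>x. (anova s f u x)\<^sup>2 \<partial>unit_cube u)"

definition sobol_index :: "nat \<Rightarrow> ((nat \<Rightarrow> real) \<Rightarrow> real) \<Rightarrow> nat set \<Rightarrow> real" where
  "sobol_index s f u = (\<Sum>v\<in>{v. v \<noteq> {} \<and> v \<subseteq> u}. anova_variance s f v)"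

text \<open>
  Separability of a function defined at every point of the cube. It is not invariant under
  changes on null sets; an element of \<open>L\<^sup>2\<close>, that is, a class of functions modulo null
  sets, is separable if some representative of it is.
\<close>

definition separable ::
  "nat \<Rightarrow> ((nat \<Rightarrow> real) \<Rightarrow> real) \<Rightarrow> nat \<Rightarrow> (nat \<Rightarrow> nat set) \<Rightarrow> bool" where
  "separable s f m u \<longleftrightarrow>
     (\<exists>g :: nat \<Rightarrow> (nat \<Rightarrow> real) \<Rightarrow> real.
        \<forall>x \<in> {1..s} \<rightarrow>\<^sub>E {0..1}. f x = (\<Sum>j=1..m. g j (restrict x (u j))))"

definition separable_L2 ::
  "nat \<Rightarrow> ((nat \<Rightarrow> real) \<Rightarrow> real) \<Rightarrow> nat \<Rightarrow> (nat \<Rightarrow> nat set) \<Rightarrow> bool" where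
  "separable_L2 s f m u \<longleftrightarrow>
     (\<exists>h. (AE x in unit_cube {1..s}. h x = f x) \<and> separable s h m u)"

lemma space_unit_cube: "space (unit_cube u) = u \<rightarrow>\<^sub>E {0..1}"
  by (simp add: unit_cube_def space_PiM space_restrict_space)

lemma anova_empty: "anova s f {} x = (\<integral>y. f y \<partial>unit_cube {1..s})"
proof -
  have "merge {} {1..s} (x, y) = y" if "y \<in> space (unit_cube {1..s})" for y
    using that by (auto simp: space_unit_cube merge_def PiE_def extensional_def)
  then have "(\<integral>y. f (merge {} {1..s} (x, y)) \<partial>unit_cube {1..s}) = (\<integral>y. f y \<partial>unit_cube {1..s})"
    by (intro Bochner_Integration.integral_cong) auto
  then show ?thesis
    by (simp add: anova.simps)
qed

lemma integral_unit_cube_empty: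
  "(\<integral>y. F y \<partial>unit_cube {}) = (F (\<lambda>_. undefined) :: real)"
proof -
  let ?M = "unit_cube {}"
  have sp: "space ?M = {\<lambda>_. undefined}"
    by (simp add: space_unit_cube)
  have "emeasure ?M {\<lambda>_. undefined} = 1"
    unfolding unit_cube_def
    by (subst emeasure_completion) (simp_all add: sets_PiM_empty emeasure_PiM_empty)
  then have "measure ?M (space ?M) = 1"
    by (simp add: sp measure_def)
  moreover have "(\<integral>y. F y \<partial>?M) = (\<integral>y. F (\<lambda>_. undefined) \<partial>?M)"
    by (intro Bochner_Integration.integral_cong) (auto simp: sp)
  ultimately show ?thesis
    by simp
qed

end

theory Submission imports Defs begin

text \<open>
  Averaging out the coordinates outside \<open>A\<close> is an orthogonal projection \<open>Q\<^sub>A\<close> on \<open>L\<^sup>2\<close> with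
  \<open>Q\<^sub>B Q\<^sub>A = Q\<^bsub>A \<inter> B\<^esub>\<close>, and \<open>Q\<^sub>A f\<close> is the sum of the ANOVA components of the subsets of \<open>A\<close>.
  Hence these components are orthogonal and the Sobol' index of \<open>A\<close> is the squared norm of
  \<open>Q\<^sub>A f - Q\<^sub>\<emptyset> f\<close>. For a partition these vectors are orthogonal to each other, so the variance
  minus the sum of the Sobol' indices is the squared norm of
  \<open>R = (f - Q\<^sub>\<emptyset> f) - (\<Sum>j. Q\<^bsub>u j\<^esub> f - Q\<^sub>\<emptyset> f)\<close>. If \<open>R = 0\<close> almost everywhere then \<open>f\<close> is separable.
  Conversely, for separable \<open>f\<close> the projection \<open>Q\<^bsub>u j\<^esub> f\<close> agrees with the \<open>j\<close>-th summand up to a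
  constant, so \<open>R\<close> is constant, and its mean is zero.
  The completion is removed by passing to a Borel representative of \<open>f\<close>.
\<close>

section \<open>Square-integrable functions and their inner products\<close>

lemma square_integrableD:
  assumes "square_integrable M f"
  shows "f \<in> borel_measurable M" "integrable M (\<lambda>x. (f x)\<^sup>2)"
  using assms by (auto simp: square_integrable_def)

lemma square_integrable_mult_integrable:
  fixes f g :: "'a \<Rightarrow> real"
  assumes f: "square_integrable M f" and g: "square_integrable M g"
  shows "integrable M (\<lambda>x. f x * g x)"
proof (rule Bochner_Integration.integrable_bound)
  note [measurable] = square_integrableD(1)[OF f] square_integrableD(1)[OF g]
  show "integrable M (\<lambda>x. (f x)\<^sup>2 + (g x)\<^sup>2)"
    using f g by (auto simp: square_integrable_def)
  show "(\<lambda>x. f x * g x) \<in> borel_measurable M" by measurable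
  have "\<bar>f x * g x\<bar> \<le> (f x)\<^sup>2 + (g x)\<^sup>2" for x
    using sum_squares_bound[of "\<bar>f x\<bar>" "\<bar>g x\<bar>"] mult_nonneg_nonneg[of "\<bar>f x\<bar>" "\<bar>g x\<bar>"]
    unfolding abs_mult power2_abs by linarith
  then show "AE x in M. norm (f x * g x) \<le> norm ((f x)\<^sup>2 + (g x)\<^sup>2)" by simp
qed

lemma square_integrable_add:
  assumes f: "square_integrable M f" and g: "square_integrable M g"
  shows "square_integrable M (\<lambda>x. f x + g x)"
proof -
  note [measurable] = square_integrableD(1)[OF f] square_integrableD(1)[OF g]
  have "integrable M (\<lambda>x. (f x)\<^sup>2 + (g x)\<^sup>2 + 2 * (f x * g x))"
    using square_integrable_mult_integrable[OF f g] f g by (auto simp: square_integrable_def)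
  then show ?thesis
    by (simp add: square_integrable_def power2_sum mult.assoc)
qed

lemma square_integrable_cmult:
  "square_integrable M f \<Longrightarrow> square_integrable M (\<lambda>x. c * f x)"
  by (auto simp: square_integrable_def power_mult_distrib)

lemma square_integrable_diff:
  assumes "square_integrable M f" "square_integrable M g"
  shows "square_integrable M (\<lambda>x. f x - g x)"
  using square_integrable_add[OF assms(1) square_integrable_cmult[OF assms(2), of "-1"]] by simp

lemma square_integrable_sum:
  "(\<And>i. i \<in> A \<Longrightarrow> square_integrable M (f i)) \<Longrightarrow> square_integrable M (\<lambda>x. \<Sum>i\<in>A. f i x)"
proof (induction A rule: infinite_finite_induct)
  case (insert a A)
  then show ?case by (simp add: square_integrable_add)
qed (simp_all add: square_integrable_def)

lemma integral_mult_sum_left: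
  assumes "\<And>i. i \<in> A \<Longrightarrow> square_integrable M (f i)" "square_integrable M g"
  shows "(\<integral>x. (\<Sum>i\<in>A. f i x) * g x \<partial>M) = (\<Sum>i\<in>A. \<integral>x. f i x * g x \<partial>M)"
  unfolding sum_distrib_right
  by (rule Bochner_Integration.integral_sum) (auto intro: square_integrable_mult_integrable assms)

lemma integral_mult_sum_right:
  assumes "\<And>i. i \<in> A \<Longrightarrow> square_integrable M (f i)" "square_integrable M g"
  shows "(\<integral>x. g x * (\<Sum>i\<in>A. f i x) \<partial>M) = (\<Sum>i\<in>A. \<integral>x. g x * f i x \<partial>M)"
  using integral_mult_sum_left[OF assms] by (simp add: mult.commute)

lemma integral_mult_diff_left:
  assumes "square_integrable M f" "square_integrable M h" "square_integrable M g"
  shows "(\<integral>x. (f x - h x) * g x \<partial>M) = (\<integral>x. f x * g x \<partial>M) - (\<integral>x. h x * g x \<partial>M)"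
  unfolding left_diff_distrib
  by (rule Bochner_Integration.integral_diff) (auto intro: square_integrable_mult_integrable assms)

lemma integral_mult_diff_right:
  assumes "square_integrable M f" "square_integrable M h" "square_integrable M g"
  shows "(\<integral>x. g x * (f x - h x) \<partial>M) = (\<integral>x. g x * f x \<partial>M) - (\<integral>x. g x * h x \<partial>M)"
  using integral_mult_diff_left[OF assms] by (simp add: mult.commute)

lemma (in prob_space) square_integrable_integrable:
  assumes "square_integrable M f"
  shows "integrable M f"
  using square_integrable_mult_integrable[OF assms, of "\<lambda>_. 1"]
  by (simp add: square_integrable_def)

text \<open>Nonnegativity of the variance. Applied to slices, it bounds the square of a coordinate
  mean by the coordinate mean of the square.\<close>

lemma (in prob_space) square_expectation_le:
  assumes "square_integrable M f"
  shows "(expectation f)\<^sup>2 \<le> expectation (\<lambda>x. (f x)\<^sup>2)"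
proof -
  have "0 \<le> variance f" by (intro Bochner_Integration.integral_nonneg) simp
  moreover have "variance f = expectation (\<lambda>x. (f x)\<^sup>2) - (expectation f)\<^sup>2"
    using assms by (intro variance_eq square_integrable_integrable square_integrableD)
  ultimately show ?thesis by linarith
qed

section \<open>Coordinate averages on a finite product of probability spaces\<close>

lemma merge_restrict_left: "merge A B (restrict x A, y) = merge A B (x, y)"
  by (auto simp: merge_def)

lemma merge_restrict_right: "merge A (B - A) (x, restrict y (B - A)) = merge A (B - A) (x, y)"
  by (auto simp: merge_def)

context finite_product_prob_space
begin

text \<open>The second argument of \<open>merge\<close> only matters on \<open>I - A\<close>, so averaging over all
  of \<open>PiM I M\<close> is averaging over the coordinates outside \<open>A\<close>.\<close>

definition coord_mean :: "'a set \<Rightarrow> (('a \<Rightarrow> 'b) \<Rightarrow> real) \<Rightarrow> ('a \<Rightarrow> 'b) \<Rightarrow> real" where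
  "coord_mean A f x = (\<integral>y. f (merge A (I - A) (x, y)) \<partial>PiM I M)"

sublocale copies: pair_prob_space "PiM I M" "PiM I M" ..

lemma measurable_merge_copies:
  assumes "A \<subseteq> I"
  shows "merge A (I - A) \<in> PiM I M \<Otimes>\<^sub>M PiM I M \<rightarrow>\<^sub>M PiM I M"
proof -
  have "(\<lambda>p. merge A (I - A) (restrict (fst p) A, restrict (snd p) (I - A)))
      \<in> PiM I M \<Otimes>\<^sub>M PiM I M \<rightarrow>\<^sub>M PiM (A \<union> (I - A)) M"
    using assms
    by (intro measurable_compose[OF _ measurable_merge] measurable_Pair
        measurable_compose[OF measurable_fst measurable_restrict_subset]
        measurable_compose[OF measurable_snd measurable_restrict_subset]) auto
  moreover have "A \<union> (I - A) = I" using assms by auto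
  ultimately show ?thesis
    by (simp add: merge_restrict_left merge_restrict_right)
qed

text \<open>Resampling the coordinates outside \<open>A\<close> from an independent copy leaves the
  law unchanged. On boxes this is the product formula, and boxes determine the product
  measure.\<close>

lemma distr_merge_copies:
  assumes A: "A \<subseteq> I"
  shows "distr (PiM I M \<Otimes>\<^sub>M PiM I M) (PiM I M) (merge A (I - A)) = PiM I M"
proof (rule PiM_eqI[OF finite_index])
  fix E assume E: "\<And>i. i \<in> I \<Longrightarrow> E i \<in> sets (M i)"
  \<comment> \<open>The preimage of a box is a product of two boxes: the first copy is constrained
    only on \<open>A\<close>, the second only outside \<open>A\<close>. The free coordinates
    contribute factors of one.\<close>
  define E1 where "E1 i = (if i \<in> A then E i else space (M i))" for i
  define E2 where "E2 i = (if i \<in> A then space (M i) else E i)" for i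
  have [simp]: "E1 i \<in> sets (M i)" "E2 i \<in> sets (M i)" if "i \<in> I" for i
    using E[OF that] by (auto simp: E1_def E2_def)
  have "merge A (I - A) -` Pi\<^sub>E I E \<inter> space (PiM I M \<Otimes>\<^sub>M PiM I M) = Pi\<^sub>E I E1 \<times> Pi\<^sub>E I E2"
  proof (intro set_eqI, clarify)
    fix x y
    have "E i \<subseteq> space (M i)" if "i \<in> I" for i
      using E[OF that] by (rule sets.sets_into_space)
    then have "(\<forall>i\<in>I. merge A (I - A) (x, y) i \<in> E i) \<and> (\<forall>i\<in>I. x i \<in> space (M i)) \<and> (\<forall>i\<in>I. y i \<in> space (M i))
        \<longleftrightarrow> (\<forall>i\<in>I. x i \<in> E1 i) \<and> (\<forall>i\<in>I. y i \<in> E2 i)"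
      unfolding ball_conj_distrib[symmetric]
      by (intro ball_cong refl) (auto simp: merge_def E1_def E2_def)
    moreover have "merge A (I - A) (x, y) \<in> extensional I"
      using A by (auto simp: merge_def extensional_def)
    ultimately show "(x, y) \<in> merge A (I - A) -` Pi\<^sub>E I E \<inter> space (PiM I M \<Otimes>\<^sub>M PiM I M)
        \<longleftrightarrow> (x, y) \<in> Pi\<^sub>E I E1 \<times> Pi\<^sub>E I E2"
      unfolding space_pair_measure space_PiM vimage_eq Int_iff mem_Times_iff PiE_iff fst_conv snd_conv
      by blast
  qed
  then have "emeasure (distr (PiM I M \<Otimes>\<^sub>M PiM I M) (PiM I M) (merge A (I - A))) (Pi\<^sub>E I E)
      = emeasure (PiM I M \<Otimes>\<^sub>M PiM I M) (Pi\<^sub>E I E1 \<times> Pi\<^sub>E I E2)"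
    using E by (subst emeasure_distr[OF measurable_merge_copies[OF A]]) (auto intro!: sets_PiM_I_finite finite_index)
  also have "\<dots> = emeasure (PiM I M) (Pi\<^sub>E I E1) * emeasure (PiM I M) (Pi\<^sub>E I E2)"
    by (rule emeasure_pair_measure_Times) (auto intro!: sets_PiM_I_finite finite_index)
  also have "\<dots> = (\<Prod>i\<in>I. emeasure (M i) (E1 i)) * (\<Prod>i\<in>I. emeasure (M i) (E2 i))"
    by (simp add: measure_times)
  also have "\<dots> = (\<Prod>i\<in>I. emeasure (M i) (E i))"
    unfolding prod.distrib[symmetric]
    by (rule prod.cong) (auto simp: E1_def E2_def M.emeasure_space_1)
  finally show "emeasure (distr (PiM I M \<Otimes>\<^sub>M PiM I M) (PiM I M) (merge A (I - A))) (Pi\<^sub>E I E)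
      = (\<Prod>i\<in>I. emeasure (M i) (E i))" .
qed simp

lemma integrable_merge_copies:
  fixes f :: "('a \<Rightarrow> 'b) \<Rightarrow> real"
  assumes "A \<subseteq> I" "integrable (PiM I M) f"
  shows "integrable (PiM I M \<Otimes>\<^sub>M PiM I M) (\<lambda>p. f (merge A (I - A) p))"
  using assms
  by (intro integrable_distr[OF measurable_merge_copies]) (simp_all add: distr_merge_copies)

lemma integral_merge_copies:
  fixes f :: "('a \<Rightarrow> 'b) \<Rightarrow> real"
  assumes "A \<subseteq> I" "f \<in> borel_measurable (PiM I M)"
  shows "(\<integral>p. f (merge A (I - A) p) \<partial>(PiM I M \<Otimes>\<^sub>M PiM I M)) = (\<integral>x. f x \<partial>PiM I M)"
  using assms integral_distr[OF measurable_merge_copies, of A f]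
  by (simp add: distr_merge_copies)

lemma AE_merge_copies:
  assumes "A \<subseteq> I" "AE x in PiM I M. P x"
  shows "AE x in PiM I M. AE y in PiM I M. P (merge A (I - A) (x, y))"
proof (rule copies.AE_pair)
  have "AE x in distr (PiM I M \<Otimes>\<^sub>M PiM I M) (PiM I M) (merge A (I - A)). P x"
    by (subst distr_merge_copies) (fact assms)+
  then show "AE p in PiM I M \<Otimes>\<^sub>M PiM I M. P (merge A (I - A) p)"
    by (rule AE_distrD[OF measurable_merge_copies[OF assms(1)]])
qed

lemma AE_integrable_slice:
  fixes f :: "('a \<Rightarrow> 'b) \<Rightarrow> real"
  assumes "A \<subseteq> I" "integrable (PiM I M) f"
  shows "AE x in PiM I M. integrable (PiM I M) (\<lambda>y. f (merge A (I - A) (x, y)))"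
  using copies.AE_integrable_fst'[OF integrable_merge_copies[OF assms]] .

lemma measurable_coord_mean:
  assumes "A \<subseteq> I" and [measurable]: "f \<in> borel_measurable (PiM I M)"
  shows "coord_mean A f \<in> borel_measurable (PiM I M)"
proof -
  note [measurable] = measurable_merge_copies[OF assms(1)]
  show ?thesis unfolding coord_mean_def[abs_def] by measurable
qed

lemma integral_coord_mean:
  assumes "A \<subseteq> I" "integrable (PiM I M) f"
  shows "(\<integral>x. coord_mean A f x \<partial>PiM I M) = (\<integral>x. f x \<partial>PiM I M)"
  unfolding coord_mean_def
  using copies.integral_fst'[OF integrable_merge_copies[OF assms]] assms
  by (simp add: integral_merge_copies)

text \<open>Jensen's inequality on almost every slice bounds the square by \<open>?g\<close>, which
  is integrable by Fubini.\<close>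

lemma square_integrable_coord_mean:
  assumes A: "A \<subseteq> I" and f: "square_integrable (PiM I M) f"
  shows "square_integrable (PiM I M) (coord_mean A f)"
proof -
  let ?g = "\<lambda>x. \<integral>y. (f (merge A (I - A) (x, y)))\<^sup>2 \<partial>PiM I M"
  have f2: "integrable (PiM I M) (\<lambda>x. (f x)\<^sup>2)" by (rule square_integrableD[OF f])
  have meas: "coord_mean A f \<in> borel_measurable (PiM I M)"
    by (intro measurable_coord_mean A square_integrableD(1)[OF f])
  have bound: "AE x in PiM I M. norm ((coord_mean A f x)\<^sup>2) \<le> norm (?g x)"
    using AE_integrable_slice[OF A f2] AE_space
  proof eventually_elim
    case (elim x)
    have "(\<lambda>y. merge A (I - A) (x, y)) \<in> PiM I M \<rightarrow>\<^sub>M PiM I M"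
      using elim by (intro measurable_compose[OF measurable_Pair1' measurable_merge_copies[OF A]])
    then have "(\<lambda>y. f (merge A (I - A) (x, y))) \<in> borel_measurable (PiM I M)"
      by (rule measurable_compose) (rule square_integrableD(1)[OF f])
    with elim have "(coord_mean A f x)\<^sup>2 \<le> ?g x"
      unfolding coord_mean_def
      by (intro P.square_expectation_le) (simp add: square_integrable_def)
    then show ?case by simp
  qed
  have int: "integrable (PiM I M) ?g"
    using copies.integrable_fst'[OF integrable_merge_copies[OF A f2]] .
  show ?thesis
    unfolding square_integrable_def
  proof
    show "integrable (PiM I M) (\<lambda>x. (coord_mean A f x)\<^sup>2)"
      by (rule Bochner_Integration.integrable_bound[OF int _ bound]) (use meas in measurable)
  qed (fact meas)
qed

lemma coord_mean_cong:
  "(\<And>i. i \<in> A \<Longrightarrow> x i = y i) \<Longrightarrow> coord_mean A f x = coord_mean A f y"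
proof -
  assume "\<And>i. i \<in> A \<Longrightarrow> x i = y i"
  then have "merge A (I - A) (x, z) = merge A (I - A) (y, z)" for z by (auto simp: merge_def)
  then show ?thesis by (simp add: coord_mean_def)
qed

lemma coord_mean_index:
  assumes "x \<in> space (PiM I M)"
  shows "coord_mean I f x = f x"
proof -
  have "merge I {} (x, y) = x" for y
    using assms by (auto simp: merge_def space_PiM PiE_def extensional_def)
  then show ?thesis by (simp add: coord_mean_def P.prob_space)
qed

lemma coord_mean_empty: "coord_mean {} f x = (\<integral>y. f y \<partial>PiM I M)"
proof -
  have "merge {} I (x, y) = y" if "y \<in> space (PiM I M)" for y
    using that by (auto simp: merge_def space_PiM PiE_def extensional_def)
  then show ?thesis
    unfolding coord_mean_def by (intro Bochner_Integration.integral_cong) auto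
qed

text \<open>Averaging twice resamples every coordinate outside \<open>A \<inter> B\<close> exactly
  once. The equality is almost everywhere because Fubini is applied to the slice through
  \<open>x\<close>, which has to be integrable.\<close>

lemma coord_mean_coord_mean:
  assumes A: "A \<subseteq> I" and f: "integrable (PiM I M) f"
  shows "AE x in PiM I M. coord_mean B (coord_mean A f) x = coord_mean (A \<inter> B) f x"
proof -
  have "A \<inter> B \<subseteq> I" using A by auto
  from AE_integrable_slice[OF this f] show ?thesis
  proof eventually_elim
    case (elim x)
    \<comment> \<open>\<open>F\<close> freezes the coordinates of \<open>x\<close> in
      \<open>A \<inter> B\<close>. The nested averages of \<open>f\<close> become the integral of a
      coordinate mean of \<open>F\<close>, so they collapse to the integral of
      \<open>F\<close>.\<close>
    define F where "F w = f (merge (A \<inter> B) (I - A \<inter> B) (x, w))" for w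
    have "merge A (I - A) (merge B (I - B) (x, y), z)
        = merge (A \<inter> B) (I - A \<inter> B) (x, merge A (I - A) (y, z))" for y z
      using A by (auto simp: merge_def)
    then have "coord_mean B (coord_mean A f) x = (\<integral>y. coord_mean A F y \<partial>PiM I M)"
      by (simp add: coord_mean_def F_def)
    also have "\<dots> = (\<integral>y. F y \<partial>PiM I M)"
      using A elim by (intro integral_coord_mean) (auto simp: F_def[abs_def])
    finally show ?case by (simp add: F_def coord_mean_def)
  qed
qed

text \<open>Resampling outside \<open>A\<close> does not change \<open>coord_mean A g\<close>, so it
  acts as a constant factor when the product is averaged. In operator terms, the projection is
  self-adjoint and idempotent.\<close>

lemma integral_mult_coord_mean:
  assumes A: "A \<subseteq> I" and f: "square_integrable (PiM I M) f" and g: "square_integrable (PiM I M) g"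
  shows "(\<integral>x. f x * coord_mean A g x \<partial>PiM I M) = (\<integral>x. coord_mean A f x * coord_mean A g x \<partial>PiM I M)"
proof -
  have int: "integrable (PiM I M) (\<lambda>x. f x * coord_mean A g x)"
    using assms by (intro square_integrable_mult_integrable square_integrable_coord_mean)
  have "(\<integral>x. f x * coord_mean A g x \<partial>PiM I M) = (\<integral>x. coord_mean A (\<lambda>x. f x * coord_mean A g x) x \<partial>PiM I M)"
    using integral_coord_mean[OF A int] by simp
  moreover have "coord_mean A g (merge A (I - A) (x, y)) = coord_mean A g x" for x y
    by (rule coord_mean_cong) (simp add: merge_def)
  then have "coord_mean A (\<lambda>x. f x * coord_mean A g x) x = coord_mean A f x * coord_mean A g x" for x
    by (simp add: coord_mean_def[of A f] coord_mean_def[of A "\<lambda>x. f x * coord_mean A g x"])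
  ultimately show ?thesis by simp
qed

text \<open>Self-adjointness applies the projection of one factor to the other factor, and composing
  projections intersects the sets. Two rounds leave \<open>A \<inter> B\<close> on both
  sides.\<close>

lemma integral_coord_mean_mult_coord_mean:
  assumes A: "A \<subseteq> I" and B: "B \<subseteq> I" and f: "square_integrable (PiM I M) f"
  shows "(\<integral>x. coord_mean A f x * coord_mean B f x \<partial>PiM I M) = (\<integral>x. (coord_mean (A \<inter> B) f x)\<^sup>2 \<partial>PiM I M)"
proof -
  have cm: "coord_mean A f \<in> borel_measurable (PiM I M)" if "A \<subseteq> I" for A
    using that by (rule measurable_coord_mean) (rule square_integrableD(1)[OF f])
  have tower: "(\<integral>x. coord_mean B (coord_mean A f) x * coord_mean D f x \<partial>PiM I M)
      = (\<integral>x. coord_mean (A \<inter> B) f x * coord_mean D f x \<partial>PiM I M)"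
    if "A \<subseteq> I" "B \<subseteq> I" "D \<subseteq> I" for A B D
  proof (rule integral_cong_AE)
    show "(\<lambda>x. coord_mean B (coord_mean A f) x * coord_mean D f x) \<in> borel_measurable (PiM I M)"
      using that by (intro borel_measurable_times measurable_coord_mean[of B] cm)
    show "(\<lambda>x. coord_mean (A \<inter> B) f x * coord_mean D f x) \<in> borel_measurable (PiM I M)"
      using that by (intro borel_measurable_times cm) auto
    show "AE x in PiM I M. coord_mean B (coord_mean A f) x * coord_mean D f x
        = coord_mean (A \<inter> B) f x * coord_mean D f x"
      using coord_mean_coord_mean[OF that(1) P.square_integrable_integrable[OF f], of B]
      by eventually_elim simp
  qed
  define C where "C = A \<inter> B"
  have C: "C \<subseteq> I" and BC: "B \<inter> C = C" using A by (auto simp: C_def)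
  have "(\<integral>x. coord_mean A f x * coord_mean B f x \<partial>PiM I M)
      = (\<integral>x. coord_mean B (coord_mean A f) x * coord_mean B f x \<partial>PiM I M)"
    by (intro integral_mult_coord_mean square_integrable_coord_mean A B f)
  also have "\<dots> = (\<integral>x. coord_mean B f x * coord_mean C f x \<partial>PiM I M)"
    using tower[OF A B B] by (simp add: mult.commute C_def)
  also have "\<dots> = (\<integral>x. coord_mean C (coord_mean B f) x * coord_mean C f x \<partial>PiM I M)"
    by (intro integral_mult_coord_mean square_integrable_coord_mean B C f)
  also have "\<dots> = (\<integral>x. coord_mean C f x * coord_mean C f x \<partial>PiM I M)"
    using tower[OF B C C] unfolding BC .
  finally show ?thesis by (simp add: power2_eq_square C_def)
qed

end

section \<open>Double sums over lower sets\<close>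

text \<open>A function of pairs of sets whose sums over lower sets only depend on the intersection
  is diagonal: this is how orthogonality of the ANOVA components comes out of the projections.\<close>

lemma off_diagonal_zero:
  fixes d :: "'a set \<Rightarrow> 'a set \<Rightarrow> real"
  assumes "finite I"
    and sum: "\<And>A B. A \<subseteq> I \<Longrightarrow> B \<subseteq> I \<Longrightarrow> (\<Sum>v\<in>Pow A. \<Sum>w\<in>Pow B. d v w) = N (A \<inter> B)"
    and "v \<subseteq> I" "w \<subseteq> I" "\<not> v \<subseteq> w"
  shows "d v w = 0"
proof -
  have fin: "finite A" if "A \<subseteq> I" for A using that assms(1) finite_subset by blast
  \<comment> \<open>Induction on \<open>v\<close>: the rows of proper subsets not below
    \<open>B\<close> vanish, and the remaining ones add up to \<open>N (v \<inter> B)\<close>. This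
    is also the sum of all rows up to \<open>v\<close>, so nothing is left for row
    \<open>v\<close>.\<close>
  have row: "(\<Sum>w\<in>Pow B. d v w) = 0" if "v \<subseteq> I" "B \<subseteq> I" "\<not> v \<subseteq> B" for v B
    using fin[OF that(1)] that
  proof (induction v rule: finite_psubset_induct)
    case (psubset v)
    let ?e = "\<lambda>v. \<Sum>w\<in>Pow B. d v w"
    have finv: "finite (Pow v)" using psubset.hyps by simp
    have "N (v \<inter> B) = (\<Sum>v'\<in>Pow v. ?e v')" using sum psubset.prems by simp
    also have "\<dots> = ?e v + (\<Sum>v'\<in>Pow v - {v}. ?e v')"
      by (rule sum.remove[OF finv]) simp
    also have "(\<Sum>v'\<in>Pow v - {v}. ?e v') = (\<Sum>v'\<in>Pow (v \<inter> B). ?e v')"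
      using finv psubset by (intro sum.mono_neutral_right) auto
    also have "\<dots> = N (v \<inter> B \<inter> B)" using psubset.prems by (intro sum) auto
    finally show ?case by (simp add: Int_assoc)
  qed
  show ?thesis using fin[OF assms(4)] assms(4,5)
  proof (induction w rule: finite_psubset_induct)
    case (psubset w)
    \<comment> \<open>The same peeling inside row \<open>v\<close>: no subset of \<open>w\<close>
      contains \<open>v\<close>, so induction removes every entry but the last.\<close>
    have "0 = (\<Sum>w'\<in>Pow w. d v w')" using row assms(3) psubset.prems by simp
    also have "\<dots> = d v w + (\<Sum>w'\<in>Pow w - {w}. d v w')"
      by (rule sum.remove) (use psubset.hyps in auto)
    also have "(\<Sum>w'\<in>Pow w - {w}. d v w') = 0"
      using psubset by (intro sum.neutral) auto
    finally show ?case by simp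
  qed
qed

text \<open>For distinct sets at least one is not contained in the other, so symmetry turns the
  one-sided vanishing into vanishing off the diagonal. It serves as the Pythagorean theorem with
  \<open>d\<close> the Gram matrix of the ANOVA components.\<close>

lemma sum_diagonal:
  fixes d :: "'a set \<Rightarrow> 'a set \<Rightarrow> real"
  assumes fin: "finite I" and sym: "\<And>v w. d v w = d w v"
    and sum: "\<And>A B. A \<subseteq> I \<Longrightarrow> B \<subseteq> I \<Longrightarrow> (\<Sum>v\<in>Pow A. \<Sum>w\<in>Pow B. d v w) = N (A \<inter> B)"
    and A: "A \<subseteq> I"
  shows "(\<Sum>v\<in>Pow A. d v v) = N A"
proof -
  have zero: "d v w = 0" if "v \<subseteq> I" "w \<subseteq> I" "v \<noteq> w" for v w
    using off_diagonal_zero[where d=d, OF fin sum] that sym by (metis subset_antisym)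
  have "(\<Sum>w\<in>Pow A. d v w) = d v v" if "v \<in> Pow A" for v
  proof -
    have "finite (Pow A)" using A fin finite_subset by blast
    then have "(\<Sum>w\<in>Pow A. d v w) = d v v + (\<Sum>w\<in>Pow A - {v}. d v w)"
      using that by (rule sum.remove)
    also have "(\<Sum>w\<in>Pow A - {v}. d v w) = 0"
      using that A by (intro sum.neutral ballI zero) auto
    finally show ?thesis by simp
  qed
  then show ?thesis using sum[OF A A] by simp
qed

section \<open>Integrals with respect to a completed measure\<close>

text \<open>In a complete measure, a function almost everywhere equal to a measurable one is itself
  measurable. Hence the usual congruence for integrals applies.\<close>

lemma integral_completion_cong_AE:
  fixes f g :: "'a \<Rightarrow> real"
  assumes ae: "AE x in M. f x = g x" and g: "g \<in> borel_measurable M"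
  shows "(\<integral>x. f x \<partial>completion M) = (\<integral>x. g x \<partial>M)"
proof -
  have g': "g \<in> borel_measurable (completion M)" using g by (rule measurable_completion)
  have ae': "AE x in completion M. f x = g x" using ae by (rule AE_completion)
  have f: "f \<in> borel_measurable (completion M)"
  proof (rule measurableI)
    fix B :: "real set" assume "B \<in> sets borel"
    then have meas: "g -` B \<inter> space (completion M) \<in> sets (completion M)"
      using g' by (rule measurable_sets[rotated])
    have "AE x in completion M. x \<in> g -` B \<inter> space (completion M)
        \<longleftrightarrow> x \<in> f -` B \<inter> space (completion M)"
      using ae' by eventually_elim simp
    from completion.in_sets_AE[OF this meas Int_lower2]
    show "f -` B \<inter> space (completion M) \<in> sets (completion M)" .
  qed simp
  have "(\<integral>x. f x \<partial>completion M) = (\<integral>x. g x \<partial>completion M)"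
    by (rule integral_cong_AE[OF f g' ae'])
  then show ?thesis using integral_completion[OF g] by simp
qed

section \<open>Marginals and slices over complementary coordinates\<close>

context finite_product_prob_space
begin

text \<open>A counterpart of \<open>AE_merge_copies\<close> in which the two arguments live on
  complementary index sets, as they do in the definition of \<open>anova\<close>.\<close>

lemma AE_merge:
  assumes A: "A \<subseteq> I" and P: "AE x in PiM I M. P x"
  shows "AE x in PiM A M. AE y in PiM (I - A) M. P (merge A (I - A) (x, y))"
proof -
  have fin: "finite A" "finite (I - A)" using A finite_index finite_subset by auto
  have AI: "A \<union> (I - A) = I" using A by auto
  interpret A: finite_product_prob_space M A by standard (rule fin)
  interpret B: finite_product_prob_space M "I - A" by standard (rule fin)
  interpret AB: pair_prob_space "PiM A M" "PiM (I - A) M" ..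
  show ?thesis
  proof (rule AB.AE_pair)
    have "distr (PiM A M \<Otimes>\<^sub>M PiM (I - A) M) (PiM I M) (merge A (I - A)) = PiM I M"
      using distr_merge[of A "I - A", OF _ fin] unfolding AI by blast
    then have "AE x in distr (PiM A M \<Otimes>\<^sub>M PiM (I - A) M) (PiM I M) (merge A (I - A)). P x"
      using P by metis
    then show "AE p in PiM A M \<Otimes>\<^sub>M PiM (I - A) M. P (merge A (I - A) p)"
      using AE_distrD[OF measurable_merge[of A "I - A" M, unfolded AI]] by blast
  qed
qed

lemma AE_restrict:
  assumes A: "A \<subseteq> I" and P: "AE x in PiM A M. P x"
  shows "AE x in PiM I M. P (restrict x A)"
proof (rule AE_distrD[where f = "\<lambda>x. restrict x A" and M' = "PiM A M" and P = P])
  show "(\<lambda>x. restrict x A) \<in> PiM I M \<rightarrow>\<^sub>M PiM A M" using A by (rule measurable_restrict_subset)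
  show "AE x in distr (PiM I M) (PiM A M) (\<lambda>x. restrict x A). P x"
    unfolding distr_restrict[OF A finite_index, symmetric] by (rule P)
qed

lemma integral_restrict:
  fixes f :: "('a \<Rightarrow> 'b) \<Rightarrow> real"
  assumes A: "A \<subseteq> I" and f: "f \<in> borel_measurable (PiM A M)"
  shows "(\<integral>x. f (restrict x A) \<partial>PiM I M) = (\<integral>x. f x \<partial>PiM A M)"
  using integral_distr[OF measurable_restrict_subset[OF A] f]
  unfolding distr_restrict[OF A finite_index, symmetric] by simp

lemma measurable_merge_complement:
  assumes "A \<subseteq> I"
  shows "merge A (I - A) \<in> PiM A M \<Otimes>\<^sub>M PiM (I - A) M \<rightarrow>\<^sub>M PiM I M"
proof -
  have "A \<union> (I - A) = I" using assms by auto
  from measurable_merge[of A "I - A" M, unfolded this] show ?thesis .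
qed

lemma measurable_merge_slice:
  assumes A: "A \<subseteq> I" and x: "x \<in> space (PiM A M)"
  shows "(\<lambda>y. merge A (I - A) (x, y)) \<in> PiM (I - A) M \<rightarrow>\<^sub>M PiM I M"
  using x by (intro measurable_compose[OF measurable_Pair1' measurable_merge_complement[OF A]])

text \<open>Connects the integral over the complementary coordinates in the ANOVA recursion with
  \<open>coord_mean\<close>, whose integral also runs over the irrelevant coordinates in
  \<open>A\<close>.\<close>

lemma integral_slice_eq_coord_mean:
  assumes A: "A \<subseteq> I" and f: "f \<in> borel_measurable (PiM I M)" and x: "x \<in> space (PiM A M)"
  shows "(\<integral>y. f (merge A (I - A) (x, y)) \<partial>PiM (I - A) M) = coord_mean A f x"
proof -
  have "(\<lambda>y. f (merge A (I - A) (x, y))) \<in> borel_measurable (PiM (I - A) M)"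
    by (rule measurable_compose[OF measurable_merge_slice[OF A x] f])
  from integral_restrict[OF Diff_subset this, symmetric] show ?thesis
    by (simp add: coord_mean_def merge_restrict_right)
qed

section \<open>Centered projections and the additive residual\<close>

lemma integral_centered_coord_mean_mult:
  assumes A: "A \<subseteq> I" and B: "B \<subseteq> I" and f: "square_integrable (PiM I M) f"
  shows "(\<integral>x. (coord_mean A f x - coord_mean {} f x) * (coord_mean B f x - coord_mean {} f x) \<partial>PiM I M)
    = (\<integral>x. (coord_mean (A \<inter> B) f x)\<^sup>2 \<partial>PiM I M) - (\<integral>x. f x \<partial>PiM I M)\<^sup>2"
proof -
  have s: "square_integrable (PiM I M) (coord_mean A f)" if "A \<subseteq> I" for A
    using that f by (rule square_integrable_coord_mean)
  have s0: "square_integrable (PiM I M) (coord_mean {} f)" by (rule s) simp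
  note s' = s[OF A] s[OF B] s0 square_integrable_diff[OF s[OF B] s0]
  \<comment> \<open>Each of the three terms involving \<open>{}\<close> equals this squared mean.
    Two occur with a minus sign and one with a plus sign, which leaves one subtraction.\<close>
  have "(\<integral>x. (coord_mean {} f x)\<^sup>2 \<partial>PiM I M) = (\<integral>x. f x \<partial>PiM I M)\<^sup>2"
    by (simp add: coord_mean_empty P.prob_space)
  then show ?thesis
    by (simp only: integral_mult_diff_left[OF s'(1,3,4)] integral_mult_diff_right[OF s'(2,3,1)]
        integral_mult_diff_right[OF s'(2,3,3)]
        integral_coord_mean_mult_coord_mean[OF _ _ f] A B empty_subsetI Int_empty_left Int_empty_right)
qed

text \<open>Writing \<open>coord_mean I f\<close>, which is \<open>f\<close> on the space, makes
  every term a coordinate mean, so that one inner product formula covers them all.\<close>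

definition additive_residual :: "'k set \<Rightarrow> ('k \<Rightarrow> 'a set) \<Rightarrow> (('a \<Rightarrow> 'b) \<Rightarrow> real) \<Rightarrow> ('a \<Rightarrow> 'b) \<Rightarrow> real" where
  "additive_residual J u f x =
     (coord_mean I f x - coord_mean {} f x) - (\<Sum>j\<in>J. coord_mean (u j) f x - coord_mean {} f x)"

lemma square_integrable_additive_residual:
  assumes "\<And>j. j \<in> J \<Longrightarrow> u j \<subseteq> I" and "square_integrable (PiM I M) f"
  shows "square_integrable (PiM I M) (additive_residual J u f)"
  unfolding additive_residual_def[abs_def]
  by (intro square_integrable_diff square_integrable_sum square_integrable_coord_mean assms) auto

lemma integral_additive_residual:
  assumes u: "\<And>j. j \<in> J \<Longrightarrow> u j \<subseteq> I" and f: "square_integrable (PiM I M) f"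
  shows "(\<integral>x. additive_residual J u f x \<partial>PiM I M) = 0"
proof -
  have s: "integrable (PiM I M) (coord_mean A f)" if "A \<subseteq> I" for A
    by (intro P.square_integrable_integrable square_integrable_coord_mean that f)
  have i: "(\<integral>x. coord_mean A f x \<partial>PiM I M) = (\<integral>x. f x \<partial>PiM I M)" if "A \<subseteq> I" for A
    by (intro integral_coord_mean that P.square_integrable_integrable f)
  show ?thesis
    using u by (simp add: additive_residual_def s i Bochner_Integration.integral_diff Bochner_Integration.integral_sum)
qed

text \<open>Expand the square of \<open>D I - S\<close>. By disjointness the cross terms and the
  square of \<open>S\<close> all equal the sum of the \<open>V (u j)\<close>, so one copy is
  subtracted in total.\<close>

lemma integral_additive_residual_square:
  assumes fin: "finite J" and u: "\<And>j. j \<in> J \<Longrightarrow> u j \<subseteq> I" and disj: "disjoint_family_on u J"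
    and f: "square_integrable (PiM I M) f"
  shows "(\<integral>x. (additive_residual J u f x)\<^sup>2 \<partial>PiM I M)
    = ((\<integral>x. (f x)\<^sup>2 \<partial>PiM I M) - (\<integral>x. f x \<partial>PiM I M)\<^sup>2)
      - (\<Sum>j\<in>J. (\<integral>x. (coord_mean (u j) f x)\<^sup>2 \<partial>PiM I M) - (\<integral>x. f x \<partial>PiM I M)\<^sup>2)"
proof -
  define D where "D A x = coord_mean A f x - coord_mean {} f x" for A x
  define V where "V A = (\<integral>x. (coord_mean A f x)\<^sup>2 \<partial>PiM I M) - (\<integral>x. f x \<partial>PiM I M)\<^sup>2" for A
  have D: "square_integrable (PiM I M) (D A)" if "A \<subseteq> I" for A
    unfolding D_def[abs_def] by (intro square_integrable_diff square_integrable_coord_mean that f) simp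
  have DD: "(\<integral>x. D A x * D B x \<partial>PiM I M) = V (A \<inter> B)" if "A \<subseteq> I" "B \<subseteq> I" for A B
    using integral_centered_coord_mean_mult[OF that f] by (simp add: D_def V_def)
  have V0: "V {} = 0" by (simp add: V_def coord_mean_empty P.prob_space)
  define S where "S x = (\<Sum>j\<in>J. D (u j) x)" for x
  have S: "square_integrable (PiM I M) S"
    unfolding S_def[abs_def] by (intro square_integrable_sum D u)
  have DI: "square_integrable (PiM I M) (D I)" by (rule D) simp
  \<comment> \<open>Used with \<open>A = I\<close> for the cross term and with
    \<open>A = u i\<close> for the rows of the square of \<open>S\<close>.\<close>
  have DS: "(\<integral>x. D A x * S x \<partial>PiM I M) = (\<Sum>j\<in>J. V (A \<inter> u j))" if "A \<subseteq> I" for A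
  proof -
    have "(\<integral>x. D A x * S x \<partial>PiM I M) = (\<Sum>j\<in>J. \<integral>x. D A x * D (u j) x \<partial>PiM I M)"
      unfolding S_def by (rule integral_mult_sum_right[OF D[OF u] D[OF that]])
    then show ?thesis using DD that u by simp
  qed
  have "(\<integral>x. S x * S x \<partial>PiM I M) = (\<Sum>i\<in>J. \<integral>x. D (u i) x * S x \<partial>PiM I M)"
    using integral_mult_sum_left[OF D[OF u] S, of J "\<lambda>i. i"] by (simp add: S_def)
  also have "\<dots> = (\<Sum>i\<in>J. V (u i))"
  proof (rule sum.cong[OF refl])
    fix i assume i: "i \<in> J"
    have "(\<Sum>j\<in>J. V (u i \<inter> u j)) = V (u i \<inter> u i) + (\<Sum>j\<in>J - {i}. V (u i \<inter> u j))"
      by (rule sum.remove[OF fin i])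
    also have "(\<Sum>j\<in>J - {i}. V (u i \<inter> u j)) = 0"
      using i by (intro sum.neutral ballI) (auto simp: disjoint_family_onD[OF disj] V0)
    finally show "(\<integral>x. D (u i) x * S x \<partial>PiM I M) = V (u i)"
      using DS u i by simp
  qed
  finally have SS: "(\<integral>x. S x * S x \<partial>PiM I M) = (\<Sum>i\<in>J. V (u i))" .
  have IS: "(\<integral>x. D I x * S x \<partial>PiM I M) = (\<Sum>j\<in>J. V (u j))"
    using DS[of I] u by (simp add: Int_absorb1)
  have "(\<integral>x. (additive_residual J u f x)\<^sup>2 \<partial>PiM I M) = (\<integral>x. (D I x - S x) * (D I x - S x) \<partial>PiM I M)"
    by (simp add: additive_residual_def D_def S_def power2_eq_square)
  also have "\<dots> = (\<integral>x. D I x * D I x \<partial>PiM I M) - (\<integral>x. D I x * S x \<partial>PiM I M)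
      - ((\<integral>x. S x * D I x \<partial>PiM I M) - (\<integral>x. S x * S x \<partial>PiM I M))"
    by (simp only: integral_mult_diff_left[OF DI S square_integrable_diff[OF DI S]]
        integral_mult_diff_right[OF DI S DI] integral_mult_diff_right[OF DI S S])
  also have "(\<integral>x. S x * D I x \<partial>PiM I M) = (\<Sum>j\<in>J. V (u j))"
    using IS by (simp add: mult.commute)
  finally have "(\<integral>x. (additive_residual J u f x)\<^sup>2 \<partial>PiM I M) = V I - (\<Sum>j\<in>J. V (u j))"
    by (simp add: DD SS IS)
  moreover have "(\<integral>x. (coord_mean I f x)\<^sup>2 \<partial>PiM I M) = (\<integral>x. (f x)\<^sup>2 \<partial>PiM I M)"
    by (intro Bochner_Integration.integral_cong) (simp_all add: coord_mean_index)
  ultimately show ?thesis by (simp add: V_def)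
qed

text \<open>No measurability of the summands \<open>h j\<close> is needed: for almost every \<open>x\<close> the slices
  of \<open>f\<close> through \<open>x\<close> and through a fixed good point differ by a constant.\<close>

lemma coord_mean_of_additive:
  assumes f: "integrable (PiM I M) f" and fin: "finite J" and disj: "disjoint_family_on u J"
    and k: "k \<in> J" "u k \<subseteq> I"
    and ae: "AE x in PiM I M. f x = (\<Sum>j\<in>J. h j (restrict x (u j)))"
  obtains K where "AE x in PiM I M. coord_mean (u k) f x = h k (restrict x (u k)) + K"
proof -
  define A where "A = u k"
  \<comment> \<open>The summands other than the \<open>k\<close>-th see only resampled coordinates.
    Intersecting with \<open>I - A\<close> covers sets \<open>u j\<close> that reach outside
    \<open>I\<close>, where \<open>merge\<close> is undefined.\<close>
  define r where "r y = (\<Sum>j\<in>J - {k}. h j (restrict y (u j \<inter> (I - A))))" for y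
  have A: "A \<subseteq> I" using k by (simp add: A_def)
  have "(\<Sum>j\<in>J. h j (restrict (merge A (I - A) (x, y)) (u j))) = h k (restrict x A) + r y" for x y
  proof -
    have "restrict (merge A (I - A) (x, y)) (u k) = restrict x A"
      by (auto simp: A_def merge_def)
    moreover have "restrict (merge A (I - A) (x, y)) (u j) = restrict y (u j \<inter> (I - A))"
      if "j \<in> J - {k}" for j
      using disjoint_family_onD[OF disj, of j k] that k by (auto simp: A_def merge_def restrict_def fun_eq_iff)
    ultimately show ?thesis
      using sum.remove[OF fin k(1), of "\<lambda>j. h j (restrict (merge A (I - A) (x, y)) (u j))"]
      by (simp add: r_def)
  qed
  then have "AE x in PiM I M. AE y in PiM I M. f (merge A (I - A) (x, y)) = h k (restrict x A) + r y"
    using AE_merge_copies[OF A ae] by simp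
  then have good: "AE x in PiM I M. integrable (PiM I M) (\<lambda>y. f (merge A (I - A) (x, y)))
      \<and> (AE y in PiM I M. f (merge A (I - A) (x, y)) = h k (restrict x A) + r y)"
    using AE_integrable_slice[OF A f] by eventually_elim simp
  \<comment> \<open>An almost sure property on a probability space holds at some point. The unknown
    term \<open>r y\<close> cancels against the slice through \<open>x0\<close>.\<close>
  then obtain x0 where x0: "integrable (PiM I M) (\<lambda>y. f (merge A (I - A) (x0, y)))"
      "AE y in PiM I M. f (merge A (I - A) (x0, y)) = h k (restrict x0 A) + r y"
    using eventually_happens'[OF P.ae_filter_bot] by blast
  have "AE x in PiM I M. coord_mean A f x = h k (restrict x A) + (coord_mean A f x0 - h k (restrict x0 A))"
    using good
  proof eventually_elim
    case (elim x)
    let ?d = "h k (restrict x A) - h k (restrict x0 A)"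
    have "coord_mean A f x = (\<integral>y. f (merge A (I - A) (x0, y)) + ?d \<partial>PiM I M)"
      unfolding coord_mean_def
    proof (rule integral_cong_AE)
      show "AE y in PiM I M. f (merge A (I - A) (x, y)) = f (merge A (I - A) (x0, y)) + ?d"
        using conjunct2[OF elim] x0(2) by eventually_elim simp
    qed (use elim x0(1) in auto)
    also have "\<dots> = coord_mean A f x0 + ?d"
      using x0(1) by (simp add: coord_mean_def P.prob_space)
    finally show ?case by simp
  qed
  then show ?thesis using that by (simp add: A_def)
qed

lemma AE_additive_residual_eq_0:
  assumes f: "square_integrable (PiM I M) f" and fin: "finite J" and disj: "disjoint_family_on u J"
    and u: "\<And>j. j \<in> J \<Longrightarrow> u j \<subseteq> I"
    and ae: "AE x in PiM I M. f x = (\<Sum>j\<in>J. h j (restrict x (u j)))"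
  shows "AE x in PiM I M. additive_residual J u f x = 0"
proof -
  have "\<exists>K. AE x in PiM I M. coord_mean (u k) f x = h k (restrict x (u k)) + K" if "k \<in> J" for k
    using coord_mean_of_additive[OF P.square_integrable_integrable[OF f] fin disj that u[OF that] ae] by blast
  then obtain K where K: "\<And>k. k \<in> J \<Longrightarrow> AE x in PiM I M. coord_mean (u k) f x = h k (restrict x (u k)) + K k"
    by metis
  let ?c = "\<integral>x. f x \<partial>PiM I M"
  let ?R = "additive_residual J u f"
  \<comment> \<open>The value of the residual once each projection is replaced by its summand plus
    \<open>K k\<close>: the summands cancel against \<open>f\<close>, and only constants
    remain.\<close>
  define L where "L = - ?c - (\<Sum>k\<in>J. K k - ?c)"
  have "AE x in PiM I M. \<forall>k\<in>J. coord_mean (u k) f x = h k (restrict x (u k)) + K k"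
    using K fin by (simp add: AE_finite_all)
  then have R: "AE x in PiM I M. ?R x = L"
    using ae AE_space
  proof eventually_elim
    case (elim x)
    then show ?case
      by (simp add: additive_residual_def coord_mean_index coord_mean_empty L_def
          sum.distrib sum_subtractf)
  qed
  have "?R \<in> borel_measurable (PiM I M)"
    by (rule square_integrableD square_integrable_additive_residual[OF u f])+
  then have "(\<integral>x. ?R x \<partial>PiM I M) = (\<integral>x. L \<partial>PiM I M)"
    by (intro integral_cong_AE R) auto
  moreover have "(\<integral>x. ?R x \<partial>PiM I M) = 0"
    by (rule integral_additive_residual[OF u f])
  ultimately have "L = 0" by (simp add: P.prob_space)
  with R show ?thesis by simp
qed

end

section \<open>ANOVA components and Sobol' indices on the unit cube\<close>

abbreviation unit_interval :: "nat \<Rightarrow> real measure" where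
  "unit_interval \<equiv> \<lambda>_. restrict_space lborel {0..1}"

lemma finite_product_prob_space_unit_interval:
  assumes "finite I"
  shows "finite_product_prob_space unit_interval I"
proof -
  have "prob_space (restrict_space lborel {0..1::real})"
    by (rule prob_spaceI) (simp add: emeasure_restrict_space space_restrict_space)
  then show ?thesis
    using assms
    by (auto simp: finite_product_prob_space_def product_prob_space_def product_prob_space_axioms_def
        finite_product_sigma_finite_def finite_product_sigma_finite_axioms_def product_sigma_finite_def
        intro: prob_space_imp_sigma_finite)
qed

locale cube_prob_space =
  fixes s :: nat

sublocale cube_prob_space \<subseteq> finite_product_prob_space unit_interval "{1..s}"
  by (rule finite_product_prob_space_unit_interval) simp

context cube_prob_space
begin

declare One_nat_def [simp del]

lemma finite_psubsets: "v \<subseteq> {1..s} \<Longrightarrow> finite {w. w \<subset> v}"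
  by (rule finite_subset[of _ "Pow {1..s}"]) auto

text \<open>Induction along the recursion: almost every slice of a null set is null, and null sets
  of lower cubes pull back to null sets. This allows \<open>f\<close> to be replaced by a Borel
  representative.\<close>

lemma anova_cong_AE:
  assumes g: "g \<in> borel_measurable (PiM {1..s} unit_interval)"
    and ae: "AE x in PiM {1..s} unit_interval. f x = g x"
    and "v \<subseteq> {1..s}"
  shows "AE x in PiM v unit_interval. anova s f v x = anova s g v x"
proof -
  have "finite v" using assms(3) finite_subset by blast
  then show ?thesis using assms(3)
  proof (induction v rule: finite_psubset_induct)
    case (psubset v)
    interpret V: finite_product_prob_space unit_interval v
      by (rule finite_product_prob_space_unit_interval[OF psubset.hyps])
    have "AE x in PiM v unit_interval. anova s f w (restrict x w) = anova s g w (restrict x w)"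
      if "w \<in> {w. w \<subset> v}" for w
      using that psubset by (intro V.AE_restrict) auto
    then have "AE x in PiM v unit_interval. \<forall>w\<in>{w. w \<subset> v}. anova s f w (restrict x w) = anova s g w (restrict x w)"
      by (intro AE_finite_allI finite_psubsets[OF psubset.prems])
    moreover have "AE x in PiM v unit_interval. AE y in PiM ({1..s} - v) unit_interval.
        f (merge v ({1..s} - v) (x, y)) = g (merge v ({1..s} - v) (x, y))"
      by (rule AE_merge[OF psubset.prems ae])
    ultimately show ?case
      using AE_space
    proof eventually_elim
      case (elim x)
      have m: "(\<lambda>y. g (merge v ({1..s} - v) (x, y))) \<in> borel_measurable (PiM ({1..s} - v) unit_interval)"
        by (rule measurable_compose[OF measurable_merge_slice[OF psubset.prems elim(3)] g])
      have "(\<integral>y. f (merge v ({1..s} - v) (x, y)) \<partial>unit_cube ({1..s} - v))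
          = (\<integral>y. g (merge v ({1..s} - v) (x, y)) \<partial>unit_cube ({1..s} - v))"
        unfolding unit_cube_def
        using integral_completion_cong_AE[OF elim(2) m] integral_completion[OF m] by simp
      then show ?case
        using elim(1) psubset.prems by (simp add: anova.simps[of s _ v])
    qed
  qed
qed

lemma integral_unit_cube_slice:
  assumes v: "v \<subseteq> {1..s}" and g: "g \<in> borel_measurable (PiM {1..s} unit_interval)"
    and x: "x \<in> space (PiM v unit_interval)"
  shows "(\<integral>y. g (merge v ({1..s} - v) (x, y)) \<partial>unit_cube ({1..s} - v)) = coord_mean v g x"
proof -
  have "(\<lambda>y. g (merge v ({1..s} - v) (x, y))) \<in> borel_measurable (PiM ({1..s} - v) unit_interval)"
    by (rule measurable_compose[OF measurable_merge_slice[OF v x] g])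
  from integral_completion[OF this] show ?thesis
    unfolding unit_cube_def by (simp only: integral_slice_eq_coord_mean[OF v g x])
qed

lemma restrict_in_space:
  "v \<subseteq> {1..s} \<Longrightarrow> x \<in> space (PiM {1..s} unit_interval) \<Longrightarrow> restrict x v \<in> space (PiM v unit_interval)"
  by (rule measurable_space[OF measurable_restrict_subset])

lemma coord_mean_restrict: "coord_mean v g (restrict x v) = coord_mean v g x"
  by (rule coord_mean_cong) simp

text \<open>The ANOVA recursion solved for its integral term.\<close>

lemma coord_mean_eq_sum_anova:
  assumes v: "v \<subseteq> {1..s}" and g: "g \<in> borel_measurable (PiM {1..s} unit_interval)"
    and x: "x \<in> space (PiM {1..s} unit_interval)"
  shows "coord_mean v g x = (\<Sum>w\<in>Pow v. anova s g w (restrict x w))"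
proof -
  have "anova s g v (restrict x v) = coord_mean v g x
      - (\<Sum>w\<in>{w. w \<subset> v}. anova s g w (restrict (restrict x v) w))"
    using v integral_unit_cube_slice[OF v g restrict_in_space[OF v x]]
    by (simp add: anova.simps[of s g v] coord_mean_restrict)
  moreover have "(\<Sum>w\<in>{w. w \<subset> v}. anova s g w (restrict (restrict x v) w))
      = (\<Sum>w\<in>{w. w \<subset> v}. anova s g w (restrict x w))"
    by (intro sum.cong) (auto simp: Int_absorb1)
  moreover have "Pow v = insert v {w. w \<subset> v}" by auto
  ultimately show ?thesis using finite_psubsets[OF v] by simp
qed

text \<open>Measurability on the cube of \<open>v\<close> itself lets the integral in
  \<open>anova_variance\<close> be lifted to the full cube through
  \<open>integral_restrict\<close>.\<close>

lemma measurable_anova: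
  assumes g: "g \<in> borel_measurable (PiM {1..s} unit_interval)" and "v \<subseteq> {1..s}"
  shows "anova s g v \<in> borel_measurable (PiM v unit_interval)"
proof -
  have "finite v" using assms(2) finite_subset by blast
  then show ?thesis using assms(2)
  proof (induction v rule: finite_psubset_induct)
    case (psubset v)
    have fin: "finite ({1..s} - v)" by simp
    interpret B: finite_product_prob_space unit_interval "{1..s} - v"
      by (rule finite_product_prob_space_unit_interval[OF fin])
    have "(\<lambda>p. g (merge v ({1..s} - v) p)) \<in> borel_measurable
        (PiM v unit_interval \<Otimes>\<^sub>M PiM ({1..s} - v) unit_interval)"
      by (rule measurable_compose[OF measurable_merge_complement[OF psubset.prems] g])
    then have "(\<lambda>x. \<integral>y. g (merge v ({1..s} - v) (x, y)) \<partial>PiM ({1..s} - v) unit_interval)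
        \<in> borel_measurable (PiM v unit_interval)"
      by (intro B.borel_measurable_lebesgue_integral) (simp add: case_prod_beta')
    moreover have "(\<lambda>x. anova s g w (restrict x w)) \<in> borel_measurable (PiM v unit_interval)"
      if "w \<in> {w. w \<subset> v}" for w
      using that psubset
      by (intro measurable_compose[OF measurable_restrict_subset psubset.IH]) auto
    ultimately have "(\<lambda>x. (\<integral>y. g (merge v ({1..s} - v) (x, y)) \<partial>PiM ({1..s} - v) unit_interval)
        - (\<Sum>w\<in>{w. w \<subset> v}. anova s g w (restrict x w))) \<in> borel_measurable (PiM v unit_interval)"
      by (intro borel_measurable_diff borel_measurable_sum)
    moreover have "anova s g v x = (\<integral>y. g (merge v ({1..s} - v) (x, y)) \<partial>PiM ({1..s} - v) unit_interval)
        - (\<Sum>w\<in>{w. w \<subset> v}. anova s g w (restrict x w))" if "x \<in> space (PiM v unit_interval)" for x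
      using psubset.prems
      by (simp add: anova.simps[of s g v] integral_unit_cube_slice[OF psubset.prems g that]
          integral_slice_eq_coord_mean[OF psubset.prems g that])
    ultimately show ?case by (simp cong: measurable_cong)
  qed
qed

lemma square_integrable_anova:
  assumes g: "square_integrable (PiM {1..s} unit_interval) g" and "v \<subseteq> {1..s}"
  shows "square_integrable (PiM {1..s} unit_interval) (\<lambda>x. anova s g v (restrict x v))"
proof -
  have "finite v" using assms(2) finite_subset by blast
  then show ?thesis using assms(2)
  proof (induction v rule: finite_psubset_induct)
    case (psubset v)
    let ?E = "\<lambda>v x. anova s g v (restrict x v)"
    have E: "square_integrable (PiM {1..s} unit_interval) (\<lambda>x. coord_mean v g x - (\<Sum>w\<in>{w. w \<subset> v}. ?E w x))"
    proof (intro square_integrable_diff square_integrable_sum square_integrable_coord_mean g psubset.prems)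
      show "square_integrable (PiM {1..s} unit_interval) (?E w)" if "w \<in> {w. w \<subset> v}" for w
        by (rule psubset.IH) (use that psubset.prems in blast)+
    qed
    have "Pow v = insert v {w. w \<subset> v}" by auto
    then have eq: "?E v x = coord_mean v g x - (\<Sum>w\<in>{w. w \<subset> v}. ?E w x)"
      if "x \<in> space (PiM {1..s} unit_interval)" for x
      using coord_mean_eq_sum_anova[OF psubset.prems square_integrableD(1)[OF g] that]
        finite_psubsets[OF psubset.prems] by simp
    have "?E v \<in> borel_measurable (PiM {1..s} unit_interval)"
      using square_integrableD(1)[OF E] by (subst measurable_cong[OF eq])
    moreover have "integrable (PiM {1..s} unit_interval) (\<lambda>x. (?E v x)\<^sup>2)"
      using square_integrableD(2)[OF E] by (subst Bochner_Integration.integrable_cong[OF refl, of _ _ "\<lambda>x. (coord_mean v g x - (\<Sum>w\<in>{w. w \<subset> v}. ?E w x))\<^sup>2"]) (simp_all only: eq)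
    ultimately show ?case unfolding square_integrable_def ..
  qed
qed

text \<open>Pythagoras for the components below \<open>v\<close>: their double sums of inner
  products depend only on the intersection, so \<open>sum_diagonal\<close> applies.\<close>

lemma sum_integral_anova_square:
  assumes g: "square_integrable (PiM {1..s} unit_interval) g" and v: "v \<subseteq> {1..s}"
  shows "(\<Sum>w\<in>Pow v. \<integral>x. (anova s g w (restrict x w))\<^sup>2 \<partial>PiM {1..s} unit_interval)
    = (\<integral>x. (coord_mean v g x)\<^sup>2 \<partial>PiM {1..s} unit_interval)"
proof -
  define E where "E w x = anova s g w (restrict x w)" for w x
  define d where "d w w' = (\<integral>x. E w x * E w' x \<partial>PiM {1..s} unit_interval)" for w w'
  have E: "square_integrable (PiM {1..s} unit_interval) (E w)" if "w \<in> Pow A" "A \<subseteq> {1..s}" for w A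
    unfolding E_def[abs_def] using that by (intro square_integrable_anova g) auto
  have sq: "square_integrable (PiM {1..s} unit_interval) (\<lambda>x. \<Sum>w\<in>Pow A. E w x)" if "A \<subseteq> {1..s}" for A
    using E that by (intro square_integrable_sum) auto
  have sum: "(\<Sum>w\<in>Pow A. \<Sum>w'\<in>Pow B. d w w') = (\<integral>x. (coord_mean (A \<inter> B) g x)\<^sup>2 \<partial>PiM {1..s} unit_interval)"
    if "A \<subseteq> {1..s}" "B \<subseteq> {1..s}" for A B
  proof -
    have "(\<integral>x. coord_mean A g x * coord_mean B g x \<partial>PiM {1..s} unit_interval)
        = (\<integral>x. (\<Sum>w\<in>Pow A. E w x) * (\<Sum>w'\<in>Pow B. E w' x) \<partial>PiM {1..s} unit_interval)"
      unfolding E_def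
      by (rule Bochner_Integration.integral_cong[OF refl])
        (simp only: coord_mean_eq_sum_anova[OF that(1) square_integrableD(1)[OF g]]
          coord_mean_eq_sum_anova[OF that(2) square_integrableD(1)[OF g]])
    also have "\<dots> = (\<Sum>w\<in>Pow A. \<integral>x. E w x * (\<Sum>w'\<in>Pow B. E w' x) \<partial>PiM {1..s} unit_interval)"
      by (rule integral_mult_sum_left[OF E[OF _ that(1)] sq[OF that(2)]])
    also have "\<dots> = (\<Sum>w\<in>Pow A. \<Sum>w'\<in>Pow B. d w w')"
      unfolding d_def
      by (intro sum.cong refl integral_mult_sum_right[OF E[OF _ that(2)] E[OF _ that(1)]])
    finally show ?thesis
      by (simp only: integral_coord_mean_mult_coord_mean[OF that g])
  qed
  have "(\<Sum>w\<in>Pow v. d w w) = (\<integral>x. (coord_mean v g x)\<^sup>2 \<partial>PiM {1..s} unit_interval)"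
    by (rule sum_diagonal[of "{1..s}" d, OF _ _ sum v]) (simp_all add: d_def mult.commute)
  then show ?thesis by (simp add: d_def E_def power2_eq_square)
qed

text \<open>The Pythagorean sum without its term for \<open>{}\<close>, which is the squared
  mean.\<close>

lemma sobol_index_eq:
  assumes g: "square_integrable (PiM {1..s} unit_interval) g"
    and ae: "AE x in PiM {1..s} unit_interval. f x = g x"
    and v: "v \<subseteq> {1..s}"
  shows "sobol_index s f v = (\<integral>x. (coord_mean v g x)\<^sup>2 \<partial>PiM {1..s} unit_interval)
    - (\<integral>x. g x \<partial>PiM {1..s} unit_interval)\<^sup>2"
proof -
  note gm = square_integrableD(1)[OF g]
  let ?n = "\<lambda>w. \<integral>x. (anova s g w (restrict x w))\<^sup>2 \<partial>PiM {1..s} unit_interval"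
  have var: "anova_variance s f w = ?n w" if w: "w \<subseteq> {1..s}" for w
  proof -
    have m: "(\<lambda>x. (anova s g w x)\<^sup>2) \<in> borel_measurable (PiM w unit_interval)"
      by (intro borel_measurable_power measurable_anova gm w)
    have "AE x in PiM w unit_interval. (anova s f w x)\<^sup>2 = (anova s g w x)\<^sup>2"
      using anova_cong_AE[OF gm ae w] by eventually_elim simp
    from integral_completion_cong_AE[OF this m] show ?thesis
      unfolding anova_variance_def unit_cube_def by (simp only: integral_restrict[OF w m])
  qed
  have "finite (Pow v)" using v finite_subset by blast
  then have "(\<Sum>w\<in>Pow v. ?n w) = ?n {} + (\<Sum>w\<in>Pow v - {{}}. ?n w)"
    by (rule sum.remove) simp
  moreover have "?n {} = (\<integral>x. g x \<partial>PiM {1..s} unit_interval)\<^sup>2"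
    by (simp add: anova_empty unit_cube_def integral_completion[OF gm] P.prob_space)
  moreover have "sobol_index s f v = (\<Sum>w\<in>Pow v - {{}}. ?n w)"
    unfolding sobol_index_def using v by (intro sum.cong var) auto
  ultimately show ?thesis using sum_integral_anova_square[OF g v] by simp
qed

lemma variance_cube_eq:
  assumes g: "square_integrable (PiM {1..s} unit_interval) g"
    and ae: "AE x in PiM {1..s} unit_interval. f x = g x"
  shows "variance_cube s f = (\<integral>x. (g x)\<^sup>2 \<partial>PiM {1..s} unit_interval)
    - (\<integral>x. g x \<partial>PiM {1..s} unit_interval)\<^sup>2"
proof -
  note gm = square_integrableD(1)[OF g]
  have "AE x in PiM {1..s} unit_interval. (f x)\<^sup>2 = (g x)\<^sup>2"
    using ae by eventually_elim simp
  from integral_completion_cong_AE[OF this borel_measurable_power[OF gm]]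
    integral_completion_cong_AE[OF ae gm]
  show ?thesis by (simp add: variance_cube_def unit_cube_def)
qed

section \<open>Separability and the criterion by Sobol' indices\<close>

lemma separable_L2_iff:
  assumes m: "1 \<le> m" and u: "\<And>j. j \<in> {1..m} \<Longrightarrow> u j \<subseteq> {1..s}"
    and disj: "disjoint_family_on u {1..m}"
    and g: "square_integrable (PiM {1..s} unit_interval) g"
    and ae: "AE x in PiM {1..s} unit_interval. f x = g x"
  shows "separable_L2 s f m u \<longleftrightarrow> (AE x in PiM {1..s} unit_interval. additive_residual {1..m} u g x = 0)"
proof
  have sp: "space (PiM {1..s} unit_interval) = {1..s} \<rightarrow>\<^sub>E {0..1}"
    by (simp add: space_PiM space_restrict_space)
  {
    assume "separable_L2 s f m u"
    then obtain h k where h: "AE x in PiM {1..s} unit_interval. h x = f x"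
      and k: "\<And>x. x \<in> space (PiM {1..s} unit_interval) \<Longrightarrow> h x = (\<Sum>j=1..m. k j (restrict x (u j)))"
      unfolding separable_L2_def separable_def unit_cube_def AE_completion_iff sp by blast
    have "AE x in PiM {1..s} unit_interval. g x = (\<Sum>j=1..m. k j (restrict x (u j)))"
      using h ae AE_space by eventually_elim (use k in simp)
    then show "AE x in PiM {1..s} unit_interval. additive_residual {1..m} u g x = 0"
      using u by (intro AE_additive_residual_eq_0[OF g _ disj]) auto
  next
    assume R: "AE x in PiM {1..s} unit_interval. additive_residual {1..m} u g x = 0"
    let ?c = "\<integral>x. g x \<partial>PiM {1..s} unit_interval"
    \<comment> \<open>A zero residual writes \<open>g\<close> as its mean plus the centered
      projections. The mean is assigned to the first summand, which exists because
      \<open>1 \<le> m\<close>.\<close>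
    define k where "k j z = coord_mean (u j) g z - ?c + (if j = 1 then ?c else 0)" for j z
    define h where "h x = (\<Sum>j=1..m. k j (restrict x (u j)))" for x
    have h: "h x = (\<Sum>j=1..m. coord_mean (u j) g x - ?c) + ?c" for x
      using m unfolding h_def k_def sum.distrib by (simp add: coord_mean_restrict)
    have "AE x in PiM {1..s} unit_interval. h x = f x"
      using R ae AE_space
      by eventually_elim (simp add: h additive_residual_def coord_mean_index coord_mean_empty)
    then show "separable_L2 s f m u"
      unfolding separable_L2_def separable_def unit_cube_def AE_completion_iff
      using h_def by blast
  }
qed

end

theorem theorem2:
  fixes m s :: nat and u :: "nat \<Rightarrow> nat set" and f :: "(nat \<Rightarrow> real) \<Rightarrow> real"
  assumes "1 \<le> m" and "m \<le> s"
    and "\<And>j. j \<in> {1..m} \<Longrightarrow> u j \<noteq> {}"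
    and "disjoint_family_on u {1..m}"
    and "(\<Union>j\<in>{1..m}. u j) = {1..s}"
    and "square_integrable (unit_cube {1..s}) f"
  shows "separable_L2 s f m u \<longleftrightarrow> (\<Sum>j=1..m. sobol_index s f (u j)) = variance_cube s f"
proof -
  interpret cube_prob_space s .
  let ?P = "PiM {1..s} unit_interval"
  \<comment> \<open>\<open>f\<close> is measurable for the completed measure; its Borel
    representative \<open>g\<close> gives access to the results on the product measure.\<close>
  obtain g where gm: "g \<in> borel_measurable ?P" and ae: "AE x in ?P. f x = g x"
    using completion_ex_borel_measurable_real[of f ?P] square_integrableD(1)[OF assms(6)]
    unfolding unit_cube_def by blast
  have "integrable (completion ?P) (\<lambda>x. (g x)\<^sup>2)"
  proof (rule integrable_cong_AE_imp)
    show "integrable (completion ?P) (\<lambda>x. (f x)\<^sup>2)"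
      using square_integrableD(2)[OF assms(6)] by (simp only: unit_cube_def)
    show "(\<lambda>x. (g x)\<^sup>2) \<in> borel_measurable (completion ?P)"
      by (intro borel_measurable_power measurable_completion gm)
    show "AE x in completion ?P. (f x)\<^sup>2 = (g x)\<^sup>2"
      by (rule AE_completion) (use ae in eventually_elim, simp)
  qed
  then have g: "square_integrable ?P g"
    using gm by (simp add: square_integrable_def integrable_completion)
  have u: "u j \<subseteq> {1..s}" if "j \<in> {1..m}" for j
    using assms(5) that by blast
  let ?R = "additive_residual {1..m} u g"
  \<comment> \<open>The gap between the two sides is a squared norm, so equality means that the
    residual vanishes almost everywhere, which is separability.\<close>
  have "(\<integral>x. (?R x)\<^sup>2 \<partial>?P) = variance_cube s f - (\<Sum>j=1..m. sobol_index s f (u j))"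
    using integral_additive_residual_square[OF _ u assms(4) g]
    by (simp add: variance_cube_eq[OF g ae] sobol_index_eq[OF g ae u])
  moreover have "(\<integral>x. (?R x)\<^sup>2 \<partial>?P) = 0 \<longleftrightarrow> (AE x in ?P. ?R x = 0)"
  proof -
    have "integrable ?P (\<lambda>x. (?R x)\<^sup>2)"
      by (intro square_integrableD square_integrable_additive_residual u g)
    from integral_nonneg_eq_0_iff_AE[OF this] show ?thesis by simp
  qed
  ultimately show ?thesis
    using separable_L2_iff[OF assms(1) u assms(4) g ae] by auto
qed

end
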